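(* For every $t\in[0,1]$, $\lambda_t^{\infty}(S_t)=1$, where $S_t\subseteq[0,1]^{\infty}$ is the set of all $\lambda_t$-uniformly distributed sequences and $\lambda_t^{\infty}$ is the infinite power of the probability measure $\lambda_t$ on $[0,1]^{\infty}$.
   Context: Let $\lambda$ be Lebesgue measure on $\mathbb{R}$ and $\mathfrak{c}=2^{\aleph_0}$. Fix a family $(X_t)_{t\in[0,1]}$ of subsets of $\mathbb{R}$ such that: (1) $X_t\cap X_{t'}=\emptyset$ for $t\neq t'$; (2) for every $t\in[0,1]$ and every closed $F\subseteq\mathbb{R}$ with $\lambda(F)>0$, $\mathrm{card}(X_t\cap F)=\mathfrak{c}$; (3) for every $I'\subseteq[0,1]$ and $g\in\mathbb{R}$, $\mathrm{card}\big((g+\bigcup_{i\in I'}X_i)\,\triangle\,\bigcup_{i\in I'}X_i\big)<\mathfrak{c}$. (Such a family is known to exist.) Let $S(\mathbb{R})$ be the shift-invariant $\sigma$-algebra of subsets of $\mathbb{R}$ generated by all Lebesgue measurable sets, all sets of cardinality $<\mathfrak{c}$, and all the sets $X_t$, $t\in[0,1]$. For $t\in[0,1]$ let $\mu_t$ be a shift-invariant measure on $S(\mathbb{R})$ that extends $\lambda$ and satisfies $\mu_t(\mathbb{R}\setminus X_t)=0$ (such measures exist). Let $\lambda_t$ be the restriction of $\mu_t$ to the $\sigma$-algebra $S[0,1]=\{Y\cap[0,1]:Y\in S(\mathbb{R})\}$ of subsets of $[0,1]$, and let $C_t=X_t\cap[0,1]$. Thus $\lambda_t$ is a probability measure on $[0,1]$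 with $\lambda_t([0,1]\setminus C_t)=0$. The measure $\lambda_t^{\infty}$ is the countable product of copies of $\lambda_t$ on $[0,1]^{\infty}=[0,1]^{\mathbb{N}}$ (product $\sigma$-algebra), $\mathbb{N}=\{1,2,\dots\}$. A sequence $(x_k)_{k\in\mathbb{N}}\in[0,1]^{\infty}$ is called $\lambda_t$-uniformly distributed if for all $c,d$ with $0\le c<d\le1$, $$\lim_{n\to\infty}\frac{\#\{k: 1\le k\le n,\ x_k\in[c,d]\cap C_t\}}{n}=d-c .$$ *)

theory Defs
  imports "HOL-Probability.Probability"
begin

text \<open>The cardinal \<open>\<cc> = 2 ^ \<aleph>\<^sub>0\<close> is represented by the set \<^term>\<open>UNIV :: nat set set\<close>.\<close>

definition card_continuum :: "'a set \<Rightarrow> bool"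
  where "card_continuum A \<longleftrightarrow> A \<approx> (UNIV :: nat set set)"

definition card_below_continuum :: "'a set \<Rightarrow> bool"
  where "card_below_continuum A \<longleftrightarrow> A \<prec> (UNIV :: nat set set)"

text \<open>The standing assumptions on the family \<open>(X\<^sub>t)\<close>, \<open>t \<in> [0,1]\<close>; the values of \<open>X\<close> outside
  \<open>[0,1]\<close> are irrelevant.\<close>

definition almost_invariant_family :: "(real \<Rightarrow> real set) \<Rightarrow> bool"
  where "almost_invariant_family X \<longleftrightarrow>
    (\<forall>t\<in>{0..1}. \<forall>t'\<in>{0..1}. t \<noteq> t' \<longrightarrow> X t \<inter> X t' = {}) \<and>
    (\<forall>t\<in>{0..1}. \<forall>F. closed F \<and> emeasure lebesgue F > 0 \<longrightarrow> card_continuum (X t \<inter> F)) \<and>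
    (\<forall>I' \<subseteq> {0..1}. \<forall>g. card_below_continuum
        (sym_diff ((\<lambda>x. g + x) ` (\<Union>i\<in>I'. X i)) (\<Union>i\<in>I'. X i)))"

definition shift_invariant_sigma_algebra :: "real set set \<Rightarrow> bool"
  where "shift_invariant_sigma_algebra \<A> \<longleftrightarrow>
    sigma_algebra UNIV \<A> \<and> (\<forall>A\<in>\<A>. \<forall>g. (\<lambda>x. g + x) ` A \<in> \<A>)"

text \<open>The smallest shift-invariant \<open>\<sigma>\<close>-algebra containing the Lebesgue measurable sets, the sets of
  cardinality less than \<open>\<cc>\<close> and the sets \<open>X\<^sub>t\<close>.\<close>

definition S_algebra :: "(real \<Rightarrow> real set) \<Rightarrow> real set set"
  where "S_algebra X = \<Inter>{\<A>. shift_invariant_sigma_algebra \<A> \<and>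
    sets lebesgue \<union> {A. card_below_continuum A} \<union> X ` {0..1} \<subseteq> \<A>}"

lemma shift_invariant_sigma_algebra_S_algebra:
  "shift_invariant_sigma_algebra (S_algebra X)"
proof -
  let ?G = "sets lebesgue \<union> {A. card_below_continuum A} \<union> X ` {0..1}"
  have mem: "A \<in> S_algebra X \<longleftrightarrow>
      (\<forall>\<A>. shift_invariant_sigma_algebra \<A> \<longrightarrow> ?G \<subseteq> \<A> \<longrightarrow> A \<in> \<A>)" for A
    unfolding S_algebra_def by (simp only: Inter_iff mem_Collect_eq Ball_def imp_conjL)
  have sa: "sigma_algebra UNIV \<A>" if "shift_invariant_sigma_algebra \<A>" for \<A>
    using that unfolding shift_invariant_sigma_algebra_def by (rule conjunct1)
  have "sigma_algebra UNIV (S_algebra X)"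
    unfolding sigma_algebra_iff2
  proof (intro conjI ballI allI impI)
    show "S_algebra X \<subseteq> Pow UNIV" by simp
    show "{} \<in> S_algebra X"
      unfolding mem using sa by (simp add: sigma_algebra_iff2)
    show "UNIV - A \<in> S_algebra X" if "A \<in> S_algebra X" for A
      using that unfolding mem using sa by (simp add: sigma_algebra_iff2)
    show "(\<Union>i. A i) \<in> S_algebra X" if "range A \<subseteq> S_algebra X" for A :: "nat \<Rightarrow> real set"
      unfolding mem
    proof (intro allI impI)
      fix \<A> assume \<A>: "shift_invariant_sigma_algebra \<A>" "?G \<subseteq> \<A>"
      have "A i \<in> \<A>" for i
        using that \<A> mem[of "A i"] by (simp add: image_subset_iff)
      then have "range A \<subseteq> \<A>" by (rule image_subsetI)
      then show "(\<Union>i. A i) \<in> \<A>"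
        using sa[OF \<A>(1)] by (simp add: sigma_algebra_iff2)
    qed
  qed
  moreover have "(\<lambda>x. g + x) ` A \<in> S_algebra X" if "A \<in> S_algebra X" for A g
    using that unfolding mem by (simp add: shift_invariant_sigma_algebra_def)
  ultimately show ?thesis
    unfolding shift_invariant_sigma_algebra_def by simp
qed

text \<open>\<open>\<mu>\<close> is a shift-invariant measure on \<open>S(\<real>)\<close> that extends Lebesgue measure and is concentrated
  on \<open>X\<^sub>t\<close>.\<close>

definition invariant_extension :: "(real \<Rightarrow> real set) \<Rightarrow> real \<Rightarrow> real measure \<Rightarrow> bool"
  where "invariant_extension X t \<mu> \<longleftrightarrow>
    space \<mu> = UNIV \<and> sets \<mu> = S_algebra X \<and>
    (\<forall>A\<in>sets \<mu>. \<forall>g. emeasure \<mu> ((\<lambda>x. g + x) ` A) = emeasure \<mu> A) \<and>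
    (\<forall>A\<in>sets lebesgue. emeasure \<mu> A = emeasure lebesgue A) \<and>
    emeasure \<mu> (UNIV - X t) = 0"

text \<open>\<^const>\<open>restrict_space\<close> has the \<open>\<sigma>\<close>-algebra of all \<open>Y \<inter> [0,1]\<close>, \<open>Y \<in> S(\<real>)\<close>; since \<open>[0,1]\<close> is
  itself in \<open>S(\<real>)\<close>, its measure is that of \<open>\<mu>\<close> on these sets.\<close>

definition unit_restriction :: "real measure \<Rightarrow> real measure"
  where "unit_restriction \<mu> = restrict_space \<mu> {0..1}"

text \<open>Sequences are indexed by \<open>{1, 2, \<dots>}\<close>, as extensional functions on \<^term>\<open>{1::nat..}\<close>, so that they
  are the points of the product space \<open>\<Pi>\<^sub>M k\<in>{1..}. M\<close>.\<close>

definition infinite_power :: "real measure \<Rightarrow> (nat \<Rightarrow> real) measure"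
  where "infinite_power M = (\<Pi>\<^sub>M k\<in>{1..}. M)"

definition ud_sequences :: "(real \<Rightarrow> real set) \<Rightarrow> real \<Rightarrow> (nat \<Rightarrow> real) set"
  where "ud_sequences X t = {x \<in> {1..} \<rightarrow>\<^sub>E {0..1}. \<forall>c d. 0 \<le> c \<and> c < d \<and> d \<le> 1 \<longrightarrow>
    (\<lambda>n. real (card {k. 1 \<le> k \<and> k \<le> n \<and> x k \<in> {c..d} \<inter> (X t \<inter> {0..1})}) / real n)
      \<longlonglongrightarrow> d - c}"

end

theory Submission
  imports Defs
begin

text \<open>Under \<open>\<lambda>\<^sub>t\<^sup>\<infinity>\<close> the indicators of \<open>x\<^sub>k \<in> [c,d] \<inter> C\<^sub>t\<close> are independent with mean \<open>d - c\<close>, so for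
  fixed \<open>c < d\<close> the strong law of large numbers (here from Hoeffding's inequality and the
  Borel--Cantelli lemma) gives the required limit almost surely. Countably many rational pairs are
  handled simultaneously, and monotonicity in \<open>[c,d]\<close> extends the limit to all real pairs; this
  reduction to rationals also yields measurability of the set of uniformly distributed sequences.\<close>

text \<open>Hoeffding bounds the probability that the mean of the first n variables is off by at
  least e by a geometric sequence in n. Its sum is finite, so by Borel--Cantelli almost every point
  has only finitely many such deviations.\<close>

lemma (in prob_space) strong_law_bounded:
  fixes Y :: "nat \<Rightarrow> 'a \<Rightarrow> real"
  assumes indep: "indep_vars (\<lambda>_. borel) Y {1..}"
    and bounded: "\<And>i. 1 \<le> i \<Longrightarrow> AE x in M. Y i x \<in> {a..b}"
    and mean: "\<And>i. 1 \<le> i \<Longrightarrow> expectation (Y i) = m"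
    and "a < b"
  shows "AE x in M. (\<lambda>n. (\<Sum>i=1..n. Y i x) / real n) \<longlonglongrightarrow> m"
proof -
  have rv: "random_variable borel (Y i)" if "1 \<le> i" for i
    using indep that unfolding indep_vars_def by auto
  have meas [measurable]: "(\<lambda>x. \<Sum>i=1..n. Y i x) \<in> borel_measurable M" for n
    by (intro borel_measurable_sum rv) auto
  \<comment> \<open>The deviation is measured on the sum, as in Hoeffding's inequality, and thus
    without division. For n = 0 the event is the whole space, which is harmless since only large n
    matter.\<close>
  define A where "A e n = {x \<in> space M. \<bar>(\<Sum>i=1..n. Y i x) - real n * m\<bar> \<ge> real n * e}" for e n
  have A [measurable]: "A e n \<in> events" for e n
    unfolding A_def by measurable
  have prob_A: "prob (A e n) \<le> 2 * exp (-2 * e\<^sup>2 / (b - a)\<^sup>2) ^ n" if "e > 0" "n \<ge> 1" for e n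
  proof -
    interpret Hoeffding_ineq M "{1..n}" Y "\<lambda>_. a" "\<lambda>_. b" "\<Sum>i=1..n. expectation (Y i)"
      by unfold_locales (use bounded in \<open>auto intro: indep_vars_subset[OF indep]\<close>)
    have "(\<Sum>i=1..n. expectation (Y i)) = real n * m"
      by (simp add: mean)
    then have "prob (A e n) \<le> 2 * exp (-2 * (real n * e)\<^sup>2 / (\<Sum>i=1..n. (b - a)\<^sup>2))"
      using Hoeffding_ineq_abs_ge[of "real n * e"] that \<open>a < b\<close> unfolding A_def by simp
    \<comment> \<open>All n ranges have width \<open>b - a\<close>, so one factor n cancels and the
      exponent is linear in n; this is what makes the bound geometric. The cancellation needs n >
      0.\<close>
    also have "-2 * (real n * e)\<^sup>2 / (\<Sum>i=1..n. (b - a)\<^sup>2) = real n * (-2 * e\<^sup>2 / (b - a)\<^sup>2)"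
      using that by (simp add: power2_eq_square)
    finally show ?thesis
      by (simp only: exp_of_nat_mult)
  qed
  have ev: "AE x in M. \<forall>\<^sub>F n in sequentially. x \<in> space M - A e n" if "e > 0" for e
  proof (rule borel_cantelli_AE1)
    show "summable (\<lambda>n. prob (A e n))"
    proof (rule summable_comparison_test')
      show "summable (\<lambda>n. 2 * exp (-2 * e\<^sup>2 / (b - a)\<^sup>2) ^ n)"
        using that \<open>a < b\<close> by (intro summable_mult summable_geometric) (simp add: divide_pos_pos)
      show "norm (prob (A e n)) \<le> 2 * exp (-2 * e\<^sup>2 / (b - a)\<^sup>2) ^ n" if "n \<ge> 1" for n
        using prob_A[OF \<open>e > 0\<close> that] by simp
    qed
  qed (auto simp: less_top[symmetric])
  \<comment> \<open>Only countably many tolerances are used, so that their exceptional null sets can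
    be united.\<close>
  have "AE x in M. \<forall>j. \<forall>\<^sub>F n in sequentially. x \<in> space M - A (inverse (real (Suc j))) n"
    unfolding AE_all_countable by (intro allI ev) simp
  then show ?thesis
  proof eventually_elim
    case (elim x)
    show ?case
    proof (rule tendstoI)
      fix e :: real assume "e > 0"
      then obtain j where j: "inverse (real (Suc j)) < e"
        using reals_Archimedean by blast
      show "\<forall>\<^sub>F n in sequentially. dist ((\<Sum>i=1..n. Y i x) / real n) m < e"
        using elim[rule_format, of j] eventually_gt_at_top[of 0]
      proof eventually_elim
        case (elim n)
        then have "\<bar>(\<Sum>i=1..n. Y i x) - real n * m\<bar> < real n * inverse (real (Suc j))"
          by (auto simp: A_def)
        also have "\<dots> \<le> real n * e"
          using j by (intro mult_left_mono) auto
        finally have "\<bar>(\<Sum>i=1..n. Y i x) - real n * m\<bar> / real n < e"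
          using elim by (simp add: field_simps)
        moreover have "(\<Sum>i=1..n. Y i x) / real n - m = ((\<Sum>i=1..n. Y i x) - real n * m) / real n"
          using elim by (simp add: field_simps)
        ultimately show ?case
          by (simp add: dist_real_def)
      qed
    qed
  qed
qed

text \<open>Independence means that the joint distribution is the product of the marginals. Here the
  joint map is the identity, because points of the product space are extensional, and each marginal
  is \<open>M\<close>.\<close>

lemma (in prob_space) indep_vars_PiM_components:
  assumes "I \<noteq> {}"
  shows "prob_space.indep_vars (\<Pi>\<^sub>M i\<in>I. M) (\<lambda>_. M) (\<lambda>i x. x i) I"
proof -
  interpret P: prob_space "\<Pi>\<^sub>M i\<in>I. M"
    by (intro prob_space_PiM prob_space_axioms)
  have "distr (\<Pi>\<^sub>M i\<in>I. M) (\<Pi>\<^sub>M i\<in>I. M) (\<lambda>x. \<lambda>i\<in>I. x i) = distr (\<Pi>\<^sub>M i\<in>I. M) (\<Pi>\<^sub>M i\<in>I. M) (\<lambda>x. x)"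
    by (intro distr_cong) (auto simp: space_PiM)
  also have "\<dots> = (\<Pi>\<^sub>M i\<in>I. distr (\<Pi>\<^sub>M i\<in>I. M) M (\<lambda>x. x i))"
    by (auto simp: prob_space_axioms intro!: PiM_cong distr_PiM_component[symmetric])
  finally show ?thesis
    using assms by (subst P.indep_vars_iff_distr_eq_PiM') auto
qed

text \<open>This repeats the quotient in \<open>ud_sequences\<close> literally, so that unfolding
  both definitions identifies them. The value at n = 0 is 0 and does not affect limits.\<close>

definition empirical_freq :: "(nat \<Rightarrow> 'a) \<Rightarrow> 'a set \<Rightarrow> nat \<Rightarrow> real"
  where "empirical_freq x A n = real (card {k. 1 \<le> k \<and> k \<le> n \<and> x k \<in> A}) / real n"

lemma empirical_freq_eq_sum: "empirical_freq x A n = (\<Sum>k=1..n. indicator A (x k)) / real n"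
proof -
  have "(\<Sum>k=1..n. indicator A (x k)) = real (card {k \<in> {1..n}. x k \<in> A})"
    by (simp add: indicator_def sum.If_cases Int_def)
  then show ?thesis
    by (simp add: empirical_freq_def conj_assoc)
qed

lemma empirical_freq_mono: "A \<subseteq> B \<Longrightarrow> empirical_freq x A n \<le> empirical_freq x B n"
  unfolding empirical_freq_eq_sum by (intro divide_right_mono sum_mono) (auto simp: indicator_def)

lemma measurable_empirical_freq:
  assumes "A \<in> sets M"
  shows "(\<lambda>x. empirical_freq x A n) \<in> borel_measurable (\<Pi>\<^sub>M k\<in>{1..}. M)"
proof -
  have "(\<lambda>x. indicator A (x k) :: real) \<in> borel_measurable (\<Pi>\<^sub>M k\<in>{1..}. M)" if "k \<in> {1..n}" for k
    using assms that by (intro measurable_compose[OF measurable_component_singleton]) auto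
  then show ?thesis
    unfolding empirical_freq_eq_sum by (intro borel_measurable_divide borel_measurable_sum) auto
qed

lemma (in prob_space) AE_empirical_freq_tendsto:
  assumes A [measurable]: "A \<in> events"
  shows "AE x in (\<Pi>\<^sub>M k\<in>{1..}. M). empirical_freq x A \<longlonglongrightarrow> prob A"
proof -
  let ?P = "\<Pi>\<^sub>M k\<in>{1::nat..}. M"
  interpret P: prob_space ?P
    by (intro prob_space_PiM prob_space_axioms)
  have "AE x in ?P. (\<lambda>n. (\<Sum>i=1..n. indicator A (x i)) / real n) \<longlonglongrightarrow> prob A"
  proof (rule P.strong_law_bounded[where a = 0 and b = 1])
    show "P.indep_vars (\<lambda>_. borel) (\<lambda>i x. indicator A (x i)) {1..}"
      by (rule P.indep_vars_compose2[OF indep_vars_PiM_components]) auto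
    show "P.expectation (\<lambda>x. indicator A (x i)) = prob A" if "1 \<le> i" for i
    proof -
      \<comment> \<open>The integrand depends on coordinate i alone, so the integral is taken over
        the marginal \<open>M\<close>.\<close>
      have "P.expectation (\<lambda>x. indicator A (x i) :: real) = (\<integral>y. indicator A y \<partial>distr ?P M (\<lambda>x. x i))"
        using that by (intro integral_distr[symmetric]) auto
      also have "distr ?P M (\<lambda>x. x i) = M"
        using that by (intro distr_PiM_component prob_space_axioms) auto
      finally show ?thesis
        by simp
    qed
  qed (auto simp: indicator_def)
  then show ?thesis
    by (simp add: empirical_freq_eq_sum[abs_def])
qed

text \<open>The frequency is monotone in the interval. Rational intervals inside [c,d] bound it from
  below, those around [c,d] from above, and their lengths come arbitrarily close to d - c.\<close>

lemma ud_sequences_iff_rat: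
  "x \<in> ud_sequences X t \<longleftrightarrow> x \<in> {1..} \<rightarrow>\<^sub>E {0..1} \<and>
    (\<forall>c\<in>\<rat>. \<forall>d\<in>\<rat>. 0 \<le> c \<and> c < d \<and> d \<le> 1 \<longrightarrow>
      empirical_freq x ({c..d} \<inter> (X t \<inter> {0..1})) \<longlonglongrightarrow> d - c)"
proof (intro iffI conjI ballI impI)
  fix c d :: real
  assume "x \<in> ud_sequences X t" "0 \<le> c \<and> c < d \<and> d \<le> 1"
  then show "empirical_freq x ({c..d} \<inter> (X t \<inter> {0..1})) \<longlonglongrightarrow> d - c"
    unfolding ud_sequences_def empirical_freq_def[abs_def] by blast
next
  assume "x \<in> ud_sequences X t"
  then show "x \<in> {1..} \<rightarrow>\<^sub>E {0..1}"
    by (simp add: ud_sequences_def)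
next
  let ?f = "\<lambda>c d. empirical_freq x ({c..d} \<inter> (X t \<inter> {0..1}))"
  assume *: "x \<in> {1..} \<rightarrow>\<^sub>E {0..1} \<and>
    (\<forall>c\<in>\<rat>. \<forall>d\<in>\<rat>. 0 \<le> c \<and> c < d \<and> d \<le> 1 \<longrightarrow> ?f c d \<longlonglongrightarrow> d - c)"
  then have lim: "?f c d \<longlonglongrightarrow> d - c" if "c \<in> \<rat>" "d \<in> \<rat>" "0 \<le> c" "c < d" "d \<le> 1" for c d
    using that by blast
  have mono: "?f c d n \<le> ?f c' d' n" if "c' \<le> c" "d \<le> d'" for c d c' d' n
    using that by (intro empirical_freq_mono) auto
  have "?f c d \<longlonglongrightarrow> d - c" if cd: "0 \<le> c" "c < d" "d \<le> 1" for c d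
  proof (rule order_tendstoI)
    fix l assume "l < d - c"
    \<comment> \<open>Each endpoint moves inwards by less than e. The bound 2e \<le> d - c keeps c'
      < d', and 2e \<le> d - c - l keeps the length above l.\<close>
    define e where "e = min (d - c) (d - c - l) / 2"
    have e: "e > 0" "2 * e \<le> d - c" "2 * e \<le> d - c - l"
      using cd \<open>l < d - c\<close> by (auto simp: e_def min_def)
    obtain c' where c': "c' \<in> \<rat>" "c < c'" "c' < c + e"
      using Rats_dense_in_real[of c "c + e"] e by auto
    obtain d' where d': "d' \<in> \<rat>" "d - e < d'" "d' < d"
      using Rats_dense_in_real[of "d - e" d] e by auto
    have "?f c' d' \<longlonglongrightarrow> d' - c'"
      using cd c' d' e by (intro lim) auto
    then have "\<forall>\<^sub>F n in sequentially. l < ?f c' d' n"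
      by (rule order_tendstoD) (use c' d' e in linarith)
    then show "\<forall>\<^sub>F n in sequentially. l < ?f c d n"
      by (rule eventually_mono) (use mono[of c c' d' d] c' d' in \<open>force intro: less_le_trans\<close>)
  next
    fix u assume u: "d - c < u"
    define e where "e = (u - (d - c)) / 2"
    have e: "e > 0" "2 * e = u - (d - c)"
      using u by (auto simp: e_def)
    \<comment> \<open>The outer interval must stay within [0,1]. An endpoint 0 or 1 has no room to
      move but is itself rational, so it is kept.\<close>
    obtain c' where c': "c' \<in> \<rat>" "0 \<le> c'" "c' \<le> c" "c - e < c'"
    proof (cases "c = 0")
      case False
      then obtain q where "q \<in> \<rat>" "max 0 (c - e) < q" "q < c"
        using Rats_dense_in_real[of "max 0 (c - e)" c] cd e by auto
      then show ?thesis
        using that by simp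
    qed (use that[of 0] e in auto)
    obtain d' where d': "d' \<in> \<rat>" "d' \<le> 1" "d \<le> d'" "d' < d + e"
    proof (cases "d = 1")
      case False
      then obtain q where "q \<in> \<rat>" "d < q" "q < min 1 (d + e)"
        using Rats_dense_in_real[of d "min 1 (d + e)"] cd e by auto
      then show ?thesis
        using that by simp
    qed (use that[of 1] e in auto)
    have "?f c' d' \<longlonglongrightarrow> d' - c'"
      using cd c' d' by (intro lim) auto
    then have "\<forall>\<^sub>F n in sequentially. ?f c' d' n < u"
      by (rule order_tendstoD) (use c' d' e in linarith)
    then show "\<forall>\<^sub>F n in sequentially. ?f c d n < u"
      by (rule eventually_mono) (use mono[of c' c d d'] c' d' in \<open>force intro: le_less_trans\<close>)
  qed
  then show "x \<in> ud_sequences X t"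
    using * unfolding ud_sequences_def empirical_freq_def[abs_def] by blast
qed

lemma generators_subset_S_algebra:
  "sets lebesgue \<union> {A. card_below_continuum A} \<union> X ` {0..1} \<subseteq> S_algebra X"
  unfolding S_algebra_def by blast

theorem theorem3p13:
  fixes X :: "real \<Rightarrow> real set" and \<mu> :: "real \<Rightarrow> real measure"
  assumes "almost_invariant_family X"
    and "\<And>t. t \<in> {0..1} \<Longrightarrow> invariant_extension X t (\<mu> t)"
  shows "\<forall>t\<in>{0..1}. emeasure (infinite_power (unit_restriction (\<mu> t))) (ud_sequences X t) = 1"
proof
  fix t :: real assume t: "t \<in> {0..1}"
  define M where "M = unit_restriction (\<mu> t)"
  let ?P = "\<Pi>\<^sub>M k\<in>{1::nat..}. M"
  have \<mu>: "space (\<mu> t) = UNIV" "sets (\<mu> t) = S_algebra X"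
    "\<And>A. A \<in> sets lebesgue \<Longrightarrow> emeasure (\<mu> t) A = emeasure lebesgue A"
    "emeasure (\<mu> t) (UNIV - X t) = 0"
    using assms(2)[OF t] unfolding invariant_extension_def by auto
  have sets_leb: "A \<in> sets (\<mu> t)" if "A \<in> sets lebesgue" for A
    using generators_subset_S_algebra[of X] that \<mu>(2) by blast
  have Xt: "X t \<in> sets (\<mu> t)"
    using generators_subset_S_algebra[of X] t \<mu>(2) by blast
  have space_M: "space M = {0..1}"
    by (simp add: M_def unit_restriction_def space_restrict_space \<mu>)
  have sets_M: "A \<in> sets M" if "A \<in> sets (\<mu> t)" "A \<subseteq> {0..1}" for A
    using that sets_leb[of "{0..1}"]
    by (simp add: M_def unit_restriction_def sets_restrict_space_iff \<mu>(1))
  have emeasure_M: "emeasure M A = emeasure (\<mu> t) A" if "A \<subseteq> {0..1}" for A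
    using that sets_leb[of "{0..1}"]
    by (simp add: M_def unit_restriction_def emeasure_restrict_space \<mu>(1))
  interpret prob_space M
    by (rule prob_spaceI) (simp add: space_M emeasure_M \<mu>(3))
  have meas: "{c..d} \<inter> (X t \<inter> {0..1}) \<in> events" for c d
    using Xt sets_leb[of "{c..d}"] sets_leb[of "{0..1}"] by (intro sets_M) auto
  have prob: "prob ({c..d} \<inter> (X t \<inter> {0..1})) = d - c" if "0 \<le> c" "c < d" "d \<le> 1" for c d
  proof -
    \<comment> \<open>Removing this null set from [c,d] leaves exactly its part in
      \<open>X t\<close>, so that part keeps the Lebesgue measure d - c.\<close>
    have "UNIV - X t \<in> null_sets (\<mu> t)"
      using Xt \<mu> sets.compl_sets[OF Xt] by auto
    then have "emeasure (\<mu> t) ({c..d} - (UNIV - X t)) = emeasure (\<mu> t) {c..d}"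
      by (intro emeasure_Diff_null_set sets_leb) auto
    also have "{c..d} - (UNIV - X t) = {c..d} \<inter> (X t \<inter> {0..1})"
      using that by auto
    also have "emeasure (\<mu> t) ({c..d} \<inter> (X t \<inter> {0..1})) = emeasure M ({c..d} \<inter> (X t \<inter> {0..1}))"
      by (rule emeasure_M[symmetric]) auto
    finally have "emeasure M ({c..d} \<inter> (X t \<inter> {0..1})) = emeasure (\<mu> t) {c..d}" .
    also have "\<dots> = ennreal (d - c)"
      using that by (simp add: \<mu>(3))
    finally show ?thesis
      using that by (simp add: measure_def)
  qed
  interpret P: prob_space ?P
    by (intro prob_space_PiM prob_space_axioms)
  have ud_eq: "ud_sequences X t = {x \<in> space ?P. \<forall>c\<in>\<rat>. \<forall>d\<in>\<rat>. 0 \<le> c \<and> c < d \<and> d \<le> 1 \<longrightarrow>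
      empirical_freq x ({c..d} \<inter> (X t \<inter> {0..1})) \<longlonglongrightarrow> d - c}"
    by (simp add: set_eq_iff ud_sequences_iff_rat space_PiM space_M)
  have lim_sets: "{x \<in> space ?P. empirical_freq x ({c..d} \<inter> (X t \<inter> {0..1})) \<longlonglongrightarrow> d - c} \<in> sets ?P" for c d
  proof -
    have [measurable]: "(\<lambda>x. empirical_freq x ({c..d} \<inter> (X t \<inter> {0..1})) n) \<in> borel_measurable ?P" for n
      by (rule measurable_empirical_freq[OF meas])
    show ?thesis
      by measurable
  qed
  \<comment> \<open>The almost-sure statement alone would not suffice: \<open>emeasure\<close> is 0
    on non-measurable sets.\<close>
  have ud_sets: "ud_sequences X t \<in> sets ?P"
    unfolding ud_eq by (intro sets.sets_Collect_countable_All' sets.sets_Collect_imp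
        sets.sets_Collect_const countable_rat lim_sets)
  have "AE x in ?P. \<forall>c\<in>\<rat>. \<forall>d\<in>\<rat>. 0 \<le> c \<and> c < d \<and> d \<le> 1 \<longrightarrow>
      empirical_freq x ({c..d} \<inter> (X t \<inter> {0..1})) \<longlonglongrightarrow> d - c"
    using AE_empirical_freq_tendsto[OF meas] prob
    by (intro AE_ball_countable' countable_rat AE_impI) metis
  then have "AE x in ?P. x \<in> ud_sequences X t"
    unfolding ud_eq by auto
  then show "emeasure (infinite_power (unit_restriction (\<mu> t))) (ud_sequences X t) = 1"
    using P.emeasure_eq_1_AE[OF ud_sets] by (simp add: infinite_power_def M_def)
qed

end
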